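(* Let $A, B \in \mathbb{P}_{m}$. Then $$\operatorname{tr} F_{t}(A, B) \leq (\operatorname{tr} A)^{1-t} (\operatorname{tr} B)^{t}, \quad t \in [0,1].$$
   Context: $\mathbb{P}_{m}$ denotes the set of $m \times m$ complex (Hermitian) positive definite matrices. For $A,B\in\mathbb{P}_m$ and $t\in[0,1]$, the weighted (metric) geometric mean is $A \sharp_{t} B := A^{1/2} (A^{-1/2} B A^{-1/2})^{t} A^{1/2}$, and the new weighted spectral geometric mean is $F_{t}(A, B) := (A^{-1} \sharp_{t} B)^{1/2} A^{2-2t} (A^{-1} \sharp_{t} B)^{1/2}$. Real powers of positive definite matrices are defined by functional calculus. *)

theory Defs
  imports "HOL-Analysis.Analysis" "HOL-Library.Complex_Order"
begin

definition ctranspose :: "complex^'n^'m \<Rightarrow> complex^'m^'n" where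
  "ctranspose A = (\<chi> i j. cnj (A $ j $ i))"

definition hermitian :: "complex^'m^'m \<Rightarrow> bool" where
  "hermitian A \<longleftrightarrow> ctranspose A = A"

definition unitary :: "complex^'m^'m \<Rightarrow> bool" where
  "unitary U \<longleftrightarrow> ctranspose U ** U = mat 1 \<and> U ** ctranspose U = mat 1"

text \<open>The order on \<^typ>\<open>complex\<close> is the one of \<^theory>\<open>HOL-Library.Complex_Order\<close>:
  \<open>z \<le> w\<close> iff \<open>Re z \<le> Re w\<close> and \<open>Im z = Im w\<close>. The sum below is \<open>x\<^sup>* A x\<close>.\<close>

definition pos_def :: "(complex^'m^'m) set" where
  "pos_def = {A. hermitian A \<and> (\<forall>x. x \<noteq> 0 \<longrightarrow> 0 < (\<Sum>i\<in>UNIV. cnj (x $ i) * (A *v x) $ i))}"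

definition real_diag :: "('m \<Rightarrow> real) \<Rightarrow> complex^'m^'m" where
  "real_diag d = (\<chi> i j. if i = j then complex_of_real (d i) else 0)"

text \<open>Functional calculus for Hermitian matrices: if \<open>A = U D U\<^sup>*\<close> with \<open>U\<close> unitary and
  \<open>D\<close> real diagonal, then \<open>f(A) = U f(D) U\<^sup>*\<close>. The lemma \<open>fun_calc_eq\<close> shows that this
  does not depend on the diagonalization; by the spectral theorem every Hermitian matrix has one.
  On other matrices the value is unspecified.\<close>

definition fun_calc :: "(real \<Rightarrow> real) \<Rightarrow> complex^'m^'m \<Rightarrow> complex^'m^'m" where
  "fun_calc f A = (THE C. \<exists>U d. unitary U \<and> A = U ** real_diag d ** ctranspose U \<and>
     C = U ** real_diag (f \<circ> d) ** ctranspose U)"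

definition mpow :: "complex^'m^'m \<Rightarrow> real \<Rightarrow> complex^'m^'m" where
  "mpow A r = fun_calc (\<lambda>x. x powr r) A"

definition geom_mean :: "real \<Rightarrow> complex^'m^'m \<Rightarrow> complex^'m^'m \<Rightarrow> complex^'m^'m" where
  "geom_mean t A B =
     mpow A (1/2) ** mpow (mpow A (-1/2) ** B ** mpow A (-1/2)) t ** mpow A (1/2)"

text \<open>The new weighted spectral geometric mean \<open>F\<^sub>t(A, B)\<close>; not the classical one of
  Fiedler and Ptak, which is \<open>(A\<^sup>-\<^sup>1 \<sharp> B)\<^sup>t A (A\<^sup>-\<^sup>1 \<sharp> B)\<^sup>t\<close>.\<close>

definition spectral_geom_mean :: "real \<Rightarrow> complex^'m^'m \<Rightarrow> complex^'m^'m \<Rightarrow> complex^'m^'m" where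
  "spectral_geom_mean t A B =
     mpow (geom_mean t (matrix_inv A) B) (1/2) ** mpow A (2 - 2 * t) **
     mpow (geom_mean t (matrix_inv A) B) (1/2)"

lemma real_diag_mult_left: "(real_diag d ** W) $ i $ j = complex_of_real (d i) * W $ i $ j"
  by (simp add: real_diag_def matrix_matrix_mult_def if_distrib[of "\<lambda>x. x * _"] cong: if_cong)

lemma real_diag_mult_right: "(W ** real_diag d) $ i $ j = W $ i $ j * complex_of_real (d j)"
  by (simp add: real_diag_def matrix_matrix_mult_def if_distrib[of "\<lambda>x. _ * x"] cong: if_cong)

lemma diagonalization_unique:
  assumes U: "unitary U" and V: "unitary V"
    and eq: "U ** real_diag d ** ctranspose U = V ** real_diag e ** ctranspose V"
  shows "U ** real_diag (f \<circ> d) ** ctranspose U = V ** real_diag (f \<circ> e) ** ctranspose V"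
proof -
  define W where "W = ctranspose V ** U"
  have UU: "ctranspose U ** U = mat 1" "U ** ctranspose U = mat 1"
    and VV: "ctranspose V ** V = mat 1" "V ** ctranspose V = mat 1"
    using U V by (auto simp: unitary_def)
  have "ctranspose V ** (U ** real_diag d ** ctranspose U) ** U =
        ctranspose V ** (V ** real_diag e ** ctranspose V) ** U"
    by (simp only: eq)
  moreover have "ctranspose V ** (U ** real_diag d ** ctranspose U) ** U =
      W ** real_diag d ** (ctranspose U ** U)"
    by (simp only: W_def matrix_mul_assoc)
  moreover have "ctranspose V ** (V ** real_diag e ** ctranspose V) ** U =
      (ctranspose V ** V) ** real_diag e ** W"
    by (simp only: W_def matrix_mul_assoc)
  ultimately have *: "W ** real_diag d = real_diag e ** W"
    by (simp add: UU VV)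
  have "W $ i $ j * complex_of_real (d j) = complex_of_real (e i) * W $ i $ j" for i j
    using arg_cong[OF *, of "\<lambda>M. M $ i $ j"]
    by (simp only: real_diag_mult_left real_diag_mult_right)
  hence "W $ i $ j = 0 \<or> d j = e i" for i j
    by (metis mult.commute mult_cancel_left of_real_eq_iff)
  hence "W $ i $ j * complex_of_real (f (d j)) = complex_of_real (f (e i)) * W $ i $ j" for i j
    by (metis mult.commute mult_zero_left)
  hence "W ** real_diag (f \<circ> d) = real_diag (f \<circ> e) ** W"
    by (simp add: vec_eq_iff real_diag_mult_left real_diag_mult_right)
  hence "V ** (W ** real_diag (f \<circ> d)) ** ctranspose U =
         V ** (real_diag (f \<circ> e) ** W) ** ctranspose U" by simp
  moreover have "V ** (W ** real_diag (f \<circ> d)) ** ctranspose U =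
      (V ** ctranspose V) ** U ** real_diag (f \<circ> d) ** ctranspose U"
    by (simp only: W_def matrix_mul_assoc)
  moreover have "V ** (real_diag (f \<circ> e) ** W) ** ctranspose U =
      V ** real_diag (f \<circ> e) ** ctranspose V ** (U ** ctranspose U)"
    by (simp only: W_def matrix_mul_assoc)
  ultimately show ?thesis by (simp add: UU VV)
qed

lemma fun_calc_eq:
  assumes "unitary U" and "A = U ** real_diag d ** ctranspose U"
  shows "fun_calc f A = U ** real_diag (f \<circ> d) ** ctranspose U"
  unfolding fun_calc_def
proof (rule the_equality)
  show "\<exists>V e. unitary V \<and> A = V ** real_diag e ** ctranspose V \<and>
      U ** real_diag (f \<circ> d) ** ctranspose U = V ** real_diag (f \<circ> e) ** ctranspose V"
    using assms by blast
next
  fix C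
  assume "\<exists>V e. unitary V \<and> A = V ** real_diag e ** ctranspose V \<and>
      C = V ** real_diag (f \<circ> e) ** ctranspose V"
  then show "C = U ** real_diag (f \<circ> d) ** ctranspose U"
    using assms diagonalization_unique by blast
qed

end

theory Submission
  imports Defs
begin

text \<open>
  Put \<open>C = A\<^sup>1\<^sup>/\<^sup>2 B A\<^sup>1\<^sup>/\<^sup>2\<close>. By definition the geometric mean of \<open>A\<^sup>-\<^sup>1\<close> and \<open>B\<close> is
  \<open>A\<^sup>-\<^sup>1\<^sup>/\<^sup>2 C\<^sup>t A\<^sup>-\<^sup>1\<^sup>/\<^sup>2\<close>, so that cyclicity of the trace turns \<open>tr F\<^sub>t(A, B)\<close> into
  \<open>tr (C\<^sup>t A\<^sup>1\<^sup>-\<^sup>2\<^sup>t)\<close>, while \<open>tr A = tr (C\<^sup>0 A\<^sup>1)\<close> and \<open>tr B = tr (C\<^sup>1 A\<^sup>-\<^sup>1)\<close>.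
  The exponents \<open>(t, 1 - 2t)\<close> are the point \<open>(1 - t) (0, 1) + t (1, -1)\<close>, so the claim says that
  \<open>(p, q) \<mapsto> tr (C\<^sup>p A\<^sup>q)\<close> is log-convex along this segment.

  It is log-convex on the whole plane, for every pair of positive definite matrices: in orthonormal
  eigenbases \<open>u\<^sub>i\<close> of \<open>C\<close> and \<open>v\<^sub>j\<close> of \<open>A\<close>, with eigenvalues \<open>c\<^sub>i\<close> and \<open>a\<^sub>j\<close>, the trace is
  \<open>\<Sum>\<^sub>i\<^sub>j w\<^sub>i\<^sub>j c\<^sub>i\<^sup>p a\<^sub>j\<^sup>q\<close> with weights \<open>w\<^sub>i\<^sub>j = |\<langle>u\<^sub>i, v\<^sub>j\<rangle>|\<^sup>2 \<ge> 0\<close> that do not depend on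
  \<open>p\<close> and \<open>q\<close> (\<open>trace_mpow_mult\<close>), and the weighted Hoelder inequality applies
  (\<open>Hoelder_weighted_sum\<close>, \<open>trace_mpow_log_convex\<close>).

  The functional calculus needs a unitary diagonalization of every Hermitian matrix. The eigenvectors
  are found one after the other by maximising the Rayleigh quotient on the orthogonal complement of
  those already found (\<open>self_adjoint_eigenvector\<close>, \<open>hermitian_diagonalization\<close>).
\<close>

section \<open>The Hermitian inner product and the adjoint\<close>

definition cdot :: "complex^'m \<Rightarrow> complex^'m \<Rightarrow> complex" where
  "cdot x y = (\<Sum>i\<in>UNIV. cnj (x $ i) * y $ i)"

lemma cdot_add_right: "cdot x (y + z) = cdot x y + cdot x z"
  by (simp add: cdot_def algebra_simps sum.distrib)

lemma cdot_scaleR_right: "cdot x (r *\<^sub>R y) = of_real r * cdot x y"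
  by (simp add: cdot_def scaleR_sum_right flip: scaleR_conv_of_real)

lemma cdot_scaleR_left: "cdot (r *\<^sub>R x) y = of_real r * cdot x y"
  by (simp add: cdot_def scaleR_sum_right flip: scaleR_conv_of_real)

lemma cdot_commute: "cdot y x = cnj (cdot x y)"
  by (simp add: cdot_def mult.commute)

lemma inner_eq_Re_cdot: "inner x y = Re (cdot x y)"
  by (simp add: cdot_def inner_vec_def inner_complex_def)

lemma cdot_self: "cdot x x = of_real ((norm x)\<^sup>2)"
proof -
  have "Im (cdot x x) = 0"
    by (simp add: cdot_def)
  moreover have "Re (cdot x x) = (norm x)\<^sup>2"
    by (simp add: inner_eq_Re_cdot[symmetric] power2_norm_eq_inner)
  ultimately show ?thesis
    by (simp add: complex_eq_iff)
qed

lemma cdot_ctranspose: "cdot x (A *v y) = cdot (ctranspose A *v x) y"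
proof -
  have "cdot x (A *v y) = (\<Sum>i\<in>UNIV. \<Sum>j\<in>UNIV. cnj (x $ i) * (A $ i $ j * y $ j))"
    by (simp add: cdot_def matrix_vector_mult_def sum_distrib_left)
  also have "\<dots> = (\<Sum>j\<in>UNIV. \<Sum>i\<in>UNIV. cnj (x $ i) * (A $ i $ j * y $ j))"
    by (rule sum.swap)
  also have "\<dots> = cdot (ctranspose A *v x) y"
    by (simp add: cdot_def matrix_vector_mult_def sum_distrib_left ctranspose_def mult_ac)
  finally show ?thesis .
qed

lemma ctranspose_ctranspose [simp]: "ctranspose (ctranspose A) = A"
  by (simp add: ctranspose_def vec_eq_iff)

lemma ctranspose_mult: "ctranspose (A ** B) = ctranspose B ** ctranspose A"
  by (simp add: ctranspose_def matrix_matrix_mult_def vec_eq_iff mult.commute)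

lemma ctranspose_real_diag [simp]: "ctranspose (real_diag d) = real_diag d"
  by (simp add: ctranspose_def real_diag_def vec_eq_iff)

section \<open>The spectral theorem for Hermitian matrices\<close>

text \<open>
  A maximiser \<open>x\<close> of the Rayleigh quotient \<open>\<langle>y, f y\<rangle> / \<langle>y, y\<rangle>\<close> on \<open>W\<close> is an eigenvector: the form
  \<open>q(y) = r \<langle>y, y\<rangle> - \<langle>y, f y\<rangle>\<close>, with \<open>r\<close> the maximum, is nonnegative on \<open>W\<close> and vanishes at \<open>x\<close>, so
  its derivative at \<open>x\<close> in the direction of the residual \<open>r x - f x\<close> is zero; this derivative is
  twice the squared norm of the residual.
\<close>

lemma self_adjoint_eigenvector:
  fixes f :: "'a::euclidean_space \<Rightarrow> 'a"
  assumes f: "linear f" and adj: "\<And>x y. inner (f x) y = inner x (f y)"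
    and W: "subspace W" and inv: "\<And>x. x \<in> W \<Longrightarrow> f x \<in> W"
    and w: "w \<in> W" "w \<noteq> 0"
  obtains x r where "x \<in> W" "norm x = 1" "f x = r *\<^sub>R x"
proof -
  define S where "S = sphere 0 1 \<inter> W"
  have "compact S"
    unfolding S_def using W by (intro compact_Int_closed closed_subspace) auto
  moreover have "w /\<^sub>R norm w \<in> S"
    using w W by (auto simp: S_def subspace_scale)
  moreover have "continuous_on S (\<lambda>y. inner y (f y))"
    using f by (intro continuous_intros linear_continuous_on) (simp add: linear_conv_bounded_linear)
  ultimately obtain x where x: "x \<in> S" and max: "\<And>y. y \<in> S \<Longrightarrow> inner y (f y) \<le> inner x (f x)"
    using continuous_attains_sup[of S "\<lambda>y. inner y (f y)"] by blast
  define r where "r = inner x (f x)"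
  define q where "q y = r * inner y y - inner y (f y)" for y
  have xW: "x \<in> W" and x1: "norm x = 1"
    using x by (auto simp: S_def)
  have q_nonneg: "0 \<le> q y" if "y \<in> W" for y
  proof (cases "y = 0")
    case False
    then have "y /\<^sub>R norm y \<in> S"
      using that W by (auto simp: S_def subspace_scale)
    from max[OF this] have "inner y (f y) / (norm y)\<^sup>2 \<le> r"
      using f by (simp add: r_def linear_scale power2_eq_square divide_simps)
    then show ?thesis
      using False by (simp add: q_def divide_simps power2_norm_eq_inner mult.commute)
  qed (simp add: q_def)
  define z where "z = r *\<^sub>R x - f x"
  have zW: "z \<in> W"
    unfolding z_def using W xW inv by (intro subspace_diff subspace_scale)
  have expand: "q (x - s *\<^sub>R z) = s\<^sup>2 * q z - 2 * s * inner z z" for s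
  proof -
    have "inner x x = 1"
      using x1 by (simp add: norm_eq_1)
    moreover have "inner x (f z) = inner z (f x)"
      using adj[of x z] by (simp add: inner_commute)
    ultimately have "q (x - s *\<^sub>R z) = s\<^sup>2 * q z - 2 * s * (r * inner z x - inner z (f x))"
      using f by (simp add: q_def linear_diff linear_scale inner_diff_left inner_diff_right
          r_def[symmetric] inner_commute[of x z] power2_eq_square algebra_simps)
    moreover have "inner z z = r * inner z x - inner z (f x)"
      by (subst (2) z_def) (simp add: inner_diff_right)
    ultimately show ?thesis
      by simp
  qed
  have "z = 0"
  proof (rule ccontr)
    assume "z \<noteq> 0"
    then have n: "inner z z > 0"
      by simp
    have qz: "q z \<ge> 0"
      using q_nonneg zW by blast
    \<comment> \<open>A step so short that the linear term \<open>- 2 s \<langle>z, z\<rangle>\<close> of \<open>q (x - s z)\<close> outweighs the quadratic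
      one; adding 1 keeps the denominator positive when \<open>q z = 0\<close>.\<close>
    define s where "s = inner z z / (q z + 1)"
    have s: "s > 0" "s * q z \<le> inner z z"
      using n qz by (auto simp: s_def divide_simps)
    have "x - s *\<^sub>R z \<in> W"
      using W xW zW by (intro subspace_diff subspace_scale)
    then have "0 \<le> s * (s * q z - 2 * inner z z)"
      using q_nonneg[of "x - s *\<^sub>R z"] by (simp add: expand power2_eq_square algebra_simps)
    then have "2 * inner z z \<le> s * q z"
      using s(1) by (simp add: zero_le_mult_iff)
    then show False
      using s(2) n by linarith
  qed
  then have "f x = r *\<^sub>R x"
    by (simp add: z_def)
  with that xW x1 show ?thesis
    by blast
qed

text \<open>
  The orthogonality conditions are fewer than the dimension. Padded with zero rows they form a square
  matrix, which is singular because of these rows, and \<open>x\<close> is taken from its kernel.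
\<close>

lemma exists_orthogonal_vector:
  fixes u :: "'m \<Rightarrow> complex^'m"
  assumes "k \<notin> S"
  obtains x where "x \<noteq> 0" "\<And>i. i \<in> S \<Longrightarrow> cdot (u i) x = 0"
proof -
  define M :: "complex^'m^'m" where "M = (\<chi> i j. if i \<in> S then cnj (u i $ j) else 0)"
  have "row k M = 0"
    using assms by (simp add: M_def row_def vec_eq_iff)
  then have "\<not> invertible M"
    by (simp add: invertible_det_nz det_zero_row)
  then obtain x where x: "M *v x = 0" "x \<noteq> 0"
    by (auto simp: invertible_left_inverse matrix_left_invertible_ker)
  have "cdot (u i) x = 0" if "i \<in> S" for i
    using that arg_cong[OF x(1), of "\<lambda>y. y $ i"]
    by (simp add: M_def matrix_vector_mult_def cdot_def)
  with that x(2) show ?thesis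
    by blast
qed

text \<open>
  The induction extends an orthonormal system of eigenvectors by one vector. The orthogonal complement
  of the system is invariant under \<open>A\<close>. As the real part of \<open>cdot\<close> is the inner product of the
  underlying real Euclidean space, for which \<open>A\<close> is self-adjoint as well, the eigenvector lemma gives a
  real eigenvalue directly, and it finds an eigenvector inside the complement.
\<close>

lemma orthonormal_eigenvectors:
  fixes A :: "complex^'m^'m"
  fixes S :: "'m set"
  assumes "hermitian A" and "finite S"
  shows "\<exists>u d. \<forall>i\<in>S. A *v u i = d i *\<^sub>R u i \<and> (\<forall>j\<in>S. cdot (u i) (u j) = (if i = j then 1 else 0))"
  using assms(2)
proof (induction S rule: finite_induct)
  case (insert k S)
  then obtain u d where eig: "\<And>i. i \<in> S \<Longrightarrow> A *v u i = d i *\<^sub>R u i"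
    and orth: "\<And>i j. i \<in> S \<Longrightarrow> j \<in> S \<Longrightarrow> cdot (u i) (u j) = (if i = j then 1 else 0)"
    by metis
  have adj: "cdot (A *v x) y = cdot x (A *v y)" for x y
    using assms(1) by (simp add: cdot_ctranspose[of x] hermitian_def)
  define W where "W = {x. \<forall>i\<in>S. cdot (u i) x = 0}"
  obtain w where "w \<noteq> 0" and "\<And>i. i \<in> S \<Longrightarrow> cdot (u i) w = 0"
    by (rule exists_orthogonal_vector[OF insert.hyps(2), of u]) blast
  then have "w \<in> W" "w \<noteq> 0"
    by (simp_all add: W_def)
  moreover have "subspace W"
    by (auto simp: subspace_def W_def cdot_add_right cdot_scaleR_right) (simp add: cdot_def)
  moreover have "A *v x \<in> W" if "x \<in> W" for x
    using that by (auto simp: W_def adj[symmetric] eig cdot_scaleR_left)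
  moreover have "inner (A *v x) y = inner x (A *v y)" for x y
    by (simp add: inner_eq_Re_cdot adj)
  moreover have "linear ((*v) A)"
    by (rule linearI) (simp_all add: matrix_vector_right_distrib vec_eq_iff
        matrix_vector_mult_def scaleR_sum_right distrib_left sum.distrib)
  ultimately obtain x r where x: "x \<in> W" "norm x = 1" "A *v x = r *\<^sub>R x"
    using self_adjoint_eigenvector[of "(*v) A" W] by metis
  have ux: "cdot (u i) x = 0" if "i \<in> S" for i
    using x(1) that by (simp add: W_def)
  then have xu: "cdot x (u i) = 0" if "i \<in> S" for i
    using that cdot_commute[of x "u i"] by simp
  have "\<forall>i\<in>insert k S. A *v (u(k := x)) i = (d(k := r)) i *\<^sub>R (u(k := x)) i \<and>
      (\<forall>j\<in>insert k S. cdot ((u(k := x)) i) ((u(k := x)) j) = (if i = j then 1 else 0))"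
    using insert.hyps(2) eig orth x ux xu cdot_self[of x] by auto
  then show ?case
    by blast
qed simp

lemma hermitian_diagonalization:
  fixes A :: "complex^'m^'m"
  assumes "hermitian A"
  obtains U d where "unitary U" "A = U ** real_diag d ** ctranspose U"
proof -
  obtain u d where "\<forall>i\<in>(UNIV :: 'm set). A *v u i = d i *\<^sub>R u i \<and>
      (\<forall>j\<in>UNIV. cdot (u i) (u j) = (if i = j then 1 else 0))"
    using orthonormal_eigenvectors[OF assms finite_class.finite_UNIV] by blast
  then have eig: "A *v u i = d i *\<^sub>R u i"
    and orth: "cdot (u i) (u j) = (if i = j then 1 else 0)" for i j
    by simp_all
  define U :: "complex^'m^'m" where "U = (\<chi> i j. u j $ i)"
  have UU: "ctranspose U ** U = mat 1"
    using orth by (simp add: U_def ctranspose_def matrix_matrix_mult_def mat_def vec_eq_iff cdot_def)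
  then have U: "unitary U"
    unfolding unitary_def using matrix_left_right_inverse by blast
  have "(A ** U) $ i $ j = (U ** real_diag d) $ i $ j" for i j
    using arg_cong[OF eig[of j], of "\<lambda>x. x $ i"] unfolding real_diag_mult_right
    by (simp add: U_def matrix_matrix_mult_def matrix_vector_mult_def mult.commute
        scaleR_conv_of_real[of _ "_ :: complex"])
  then have "A ** U = U ** real_diag d"
    by (simp add: vec_eq_iff)
  then have "A ** (U ** ctranspose U) = U ** real_diag d ** ctranspose U"
    by (simp add: matrix_mul_assoc)
  with U that show ?thesis
    by (simp add: unitary_def)
qed

section \<open>Positive definite matrices and their powers\<close>

lemma pos_def_iff:
  "A \<in> pos_def \<longleftrightarrow> hermitian A \<and> (\<forall>x. x \<noteq> 0 \<longrightarrow> 0 < cdot x (A *v x))"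
  by (simp add: pos_def_def cdot_def)

lemma pos_def_congruence:
  fixes A X :: "complex^'m^'m"
  assumes "A \<in> pos_def" and "invertible X"
  shows "ctranspose X ** A ** X \<in> pos_def"
  unfolding pos_def_iff
proof (intro conjI allI impI)
  show "hermitian (ctranspose X ** A ** X)"
    using assms(1) by (simp add: pos_def_iff hermitian_def ctranspose_mult matrix_mul_assoc)
next
  fix x :: "complex^'m"
  assume "x \<noteq> 0"
  then have "X *v x \<noteq> 0"
    using assms(2) by (auto simp: invertible_left_inverse matrix_left_invertible_ker)
  moreover have "cdot x ((ctranspose X ** A ** X) *v x) = cdot (X *v x) (A *v (X *v x))"
    using cdot_ctranspose[of x "ctranspose X"] by (simp flip: matrix_vector_mul_assoc)
  ultimately show "0 < cdot x ((ctranspose X ** A ** X) *v x)"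
    using assms(1) by (simp add: pos_def_iff)
qed

lemma unitary_invertible: "unitary U \<Longrightarrow> invertible U"
  by (auto simp: unitary_def invertible_def)

lemma pos_def_real_diag:
  fixes d :: "'m::finite \<Rightarrow> real"
  shows "real_diag d \<in> pos_def \<longleftrightarrow> (\<forall>i. 0 < d i)"
proof -
  have eq: "cdot x (real_diag d *v x) = of_real (\<Sum>i\<in>UNIV. d i * (cmod (x $ i))\<^sup>2)" for x
  proof -
    have "(real_diag d *v x) $ i = of_real (d i) * x $ i" for i
      by (simp add: real_diag_def matrix_vector_mult_def if_distrib[of "\<lambda>x. x * _"] cong: if_cong)
    then show ?thesis
      unfolding cdot_def of_real_sum
      by (intro sum.cong refl) (simp only: of_real_mult complex_norm_square mult_ac)
  qed
  have pos: "0 < complex_of_real r \<longleftrightarrow> 0 < r" for r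
    by (simp add: less_complex_def)
  show ?thesis
  proof
    assume P: "real_diag d \<in> pos_def"
    show "\<forall>i. 0 < d i"
    proof
      fix i
      have "axis i 1 \<noteq> (0 :: complex^'m)"
        by (simp add: axis_eq_0_iff)
      then have "0 < (\<Sum>j\<in>UNIV. d j * (cmod ((axis i 1 :: complex^'m) $ j))\<^sup>2)"
        using P by (metis pos_def_iff eq pos)
      also have "\<dots> = (\<Sum>j\<in>UNIV. if j = i then d j else 0)"
        by (intro sum.cong) (auto simp: axis_def)
      finally show "0 < d i"
        by simp
    qed
  next
    assume d: "\<forall>i. 0 < d i"
    have "0 < (\<Sum>i\<in>UNIV. d i * (cmod (x $ i))\<^sup>2)" if nz: "x \<noteq> 0" for x :: "complex^'m"
    proof -
      obtain i where "x $ i \<noteq> 0"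
        using nz by (auto simp: vec_eq_iff)
      then show ?thesis
        using d by (intro sum_pos2[of _ i]) (auto simp: less_imp_le)
    qed
    then show "real_diag d \<in> pos_def"
      by (simp add: pos_def_iff hermitian_def eq pos del: of_real_sum of_real_mult of_real_power)
  qed
qed

lemma pos_def_diagonalization:
  fixes A :: "complex^'m^'m"
  assumes "A \<in> pos_def"
  obtains U d where "unitary U" "\<And>i. 0 < d i" "A = U ** real_diag d ** ctranspose U"
proof -
  obtain U d where U: "unitary U" and A: "A = U ** real_diag d ** ctranspose U"
    using assms hermitian_diagonalization by (auto simp: pos_def_iff)
  have "ctranspose U ** A ** U = (ctranspose U ** U) ** real_diag d ** (ctranspose U ** U)"
    by (simp only: A matrix_mul_assoc)
  then have "real_diag d \<in> pos_def"
    using pos_def_congruence[OF assms unitary_invertible[OF U]] U by (simp add: unitary_def)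
  then have "0 < d i" for i
    by (simp add: pos_def_real_diag)
  with that U A show ?thesis
    by blast
qed

lemma unitary_diag_pos_def:
  assumes "unitary U" and "\<And>i. 0 < d i"
  shows "U ** real_diag d ** ctranspose U \<in> pos_def"
proof -
  have "invertible (ctranspose U)"
    using assms(1) by (auto simp: unitary_def invertible_def)
  with assms(2) pos_def_congruence[of "real_diag d" "ctranspose U"] show ?thesis
    by (simp add: pos_def_real_diag)
qed

lemma mpow_unitary_diag:
  assumes "unitary U"
  shows "mpow (U ** real_diag d ** ctranspose U) r = U ** real_diag (\<lambda>i. d i powr r) ** ctranspose U"
  unfolding mpow_def using fun_calc_eq[OF assms refl, of "\<lambda>x. x powr r" d] by (simp add: o_def)

lemma unitary_diag_mult:
  assumes "unitary U"
  shows "(U ** real_diag d ** ctranspose U) ** (U ** real_diag e ** ctranspose U) =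
    U ** real_diag (\<lambda>i. d i * e i) ** ctranspose U"
proof -
  have "(U ** real_diag d ** ctranspose U) ** (U ** real_diag e ** ctranspose U) =
      U ** (real_diag d ** (ctranspose U ** U) ** real_diag e) ** ctranspose U"
    by (simp only: matrix_mul_assoc)
  moreover have "real_diag d ** real_diag e = real_diag (\<lambda>i. d i * e i)"
    unfolding vec_eq_iff real_diag_mult_left by (simp add: real_diag_def)
  ultimately show ?thesis
    using assms by (simp add: unitary_def)
qed

lemma mpow_pos_def:
  assumes "A \<in> pos_def"
  shows "mpow A r \<in> pos_def"
proof -
  from assms obtain U d where U: "unitary U" "\<And>i. 0 < d i"
    and A: "A = U ** real_diag d ** ctranspose U"
    by (rule pos_def_diagonalization) blast
  show ?thesis
    unfolding A mpow_unitary_diag[OF U(1)] using U(2)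
    by (intro unitary_diag_pos_def[OF U(1)]) (simp add: less_imp_neq[symmetric])
qed

lemma mpow_add:
  assumes "A \<in> pos_def"
  shows "mpow A r ** mpow A s = mpow A (r + s)"
proof -
  from assms obtain U d where U: "unitary U"
    and A: "A = U ** real_diag d ** ctranspose U"
    by (rule pos_def_diagonalization) blast
  show ?thesis
    by (simp only: A mpow_unitary_diag[OF U] unitary_diag_mult[OF U] powr_add)
qed

lemma mpow_one:
  assumes "A \<in> pos_def"
  shows "mpow A 1 = A"
proof -
  from assms obtain U d where U: "unitary U" "\<And>i. 0 < d i"
    and A: "A = U ** real_diag d ** ctranspose U"
    by (rule pos_def_diagonalization) blast
  show ?thesis
    unfolding A mpow_unitary_diag[OF U(1)] using U(2) by (simp add: less_imp_le)
qed

lemma mpow_zero: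
  assumes "A \<in> pos_def"
  shows "mpow A 0 = mat 1"
proof -
  from assms obtain U d where U: "unitary U" "\<And>i. 0 < d i"
    and A: "A = U ** real_diag d ** ctranspose U"
    by (rule pos_def_diagonalization) blast
  have "real_diag (\<lambda>i. d i powr 0) = mat 1"
    using U(2) by (simp add: real_diag_def mat_def vec_eq_iff less_imp_neq[symmetric])
  then show ?thesis
    unfolding A mpow_unitary_diag[OF U(1)] using U(1) by (simp add: unitary_def)
qed

lemma mpow_invertible:
  assumes "A \<in> pos_def"
  shows "invertible (mpow A r)"
  unfolding invertible_def using assms by (intro exI[of _ "mpow A (- r)"]) (simp add: mpow_add mpow_zero)

lemma mpow_hermitian:
  assumes "A \<in> pos_def"
  shows "ctranspose (mpow A r) = mpow A r"
  using mpow_pos_def[OF assms] by (simp add: pos_def_iff hermitian_def)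

lemma matrix_inv_unique:
  fixes A X :: "'a::semiring_1^'n^'n"
  assumes "A ** X = mat 1" and "X ** A = mat 1"
  shows "matrix_inv A = X"
  unfolding matrix_inv_def
proof (rule some_equality)
  fix Y
  assume "A ** Y = mat 1 \<and> Y ** A = mat 1"
  then have "Y = Y ** (A ** X)"
    using assms by simp
  also have "\<dots> = X"
    using \<open>A ** Y = mat 1 \<and> Y ** A = mat 1\<close> by (simp add: matrix_mul_assoc)
  finally show "Y = X" .
qed (use assms in simp)

lemma mpow_matrix_inv:
  assumes "A \<in> pos_def"
  shows "mpow (matrix_inv A) r = mpow A (- r)"
proof -
  from assms obtain U d where U: "unitary U" "\<And>i. 0 < d i"
    and A: "A = U ** real_diag d ** ctranspose U"
    by (rule pos_def_diagonalization) blast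
  have "mpow A (- 1) ** A = mat 1" and "A ** mpow A (- 1) = mat 1"
    using mpow_add[OF assms, of "- 1" 1] mpow_add[OF assms, of 1 "- 1"] assms
    by (simp_all add: mpow_one mpow_zero)
  then have "mpow (matrix_inv A) r = mpow (mpow A (- 1)) r"
    by (simp add: matrix_inv_unique)
  also have "\<dots> = mpow A (- r)"
    unfolding A mpow_unitary_diag[OF U(1)] by (simp only: powr_powr mult_minus1)
  finally show ?thesis .
qed

section \<open>Log-convexity of traces of products of powers\<close>

text \<open>
  After dividing by the two sums on the right, the claim is the sum of the weighted
  arithmetic-geometric mean inequalities for the pairs \<open>f k\<close>, \<open>g k\<close>.
\<close>

lemma Hoelder_weighted_sum:
  fixes w f g :: "'a \<Rightarrow> real"
  assumes "finite I" and w: "\<And>k. k \<in> I \<Longrightarrow> 0 \<le> w k"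
    and f: "\<And>k. k \<in> I \<Longrightarrow> 0 < f k" and g: "\<And>k. k \<in> I \<Longrightarrow> 0 < g k"
    and t: "0 \<le> t" "t \<le> 1"
  shows "(\<Sum>k\<in>I. w k * (f k powr (1 - t) * g k powr t)) \<le>
    (\<Sum>k\<in>I. w k * f k) powr (1 - t) * (\<Sum>k\<in>I. w k * g k) powr t"
proof (cases "\<forall>k\<in>I. w k = 0")
  case False
  then obtain k0 where "k0 \<in> I" "w k0 \<noteq> 0"
    by blast
  with w[of k0] have k0: "k0 \<in> I" "w k0 > 0"
    by auto
  define F where "F = (\<Sum>k\<in>I. w k * f k)"
  define G where "G = (\<Sum>k\<in>I. w k * g k)"
  have F: "F > 0" unfolding F_def
    using assms(1) k0 w f by (intro sum_pos2[of I k0]) (auto simp: less_imp_le)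
  have G: "G > 0" unfolding G_def
    using assms(1) k0 w g by (intro sum_pos2[of I k0]) (auto simp: less_imp_le)
  have "(\<Sum>k\<in>I. w k * ((f k / F) powr (1 - t) * (g k / G) powr t))
      \<le> (\<Sum>k\<in>I. w k * ((1 - t) * (f k / F) + t * (g k / G)))"
    using w f g F G t by (intro sum_mono mult_left_mono Youngs_inequality_0) auto
  also have "\<dots> = (1 - t) * ((\<Sum>k\<in>I. w k * f k) / F) + t * ((\<Sum>k\<in>I. w k * g k) / G)"
    by (simp add: sum.distrib sum_distrib_left sum_divide_distrib algebra_simps)
  also have "\<dots> = 1"
    using F G by (simp flip: F_def G_def)
  also have "(\<Sum>k\<in>I. w k * ((f k / F) powr (1 - t) * (g k / G) powr t)) =
      (\<Sum>k\<in>I. w k * (f k powr (1 - t) * g k powr t)) / (F powr (1 - t) * G powr t)"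
    unfolding sum_divide_distrib
    using f g F G by (intro sum.cong refl) (simp add: powr_divide less_imp_le)
  finally show ?thesis
    using F G by (simp add: divide_le_eq flip: F_def G_def)
qed simp

text \<open>
  The weights are the squared moduli of the entries of the change of basis \<open>U\<^sup>* V\<close> between the two
  eigenbases. They are the same for all exponents.
\<close>

lemma trace_mpow_mult:
  fixes A C :: "complex^'m^'m"
  assumes "A \<in> pos_def" and "C \<in> pos_def"
  obtains w c a where "\<And>i j. 0 \<le> w i j" "\<And>i. 0 < c i" "\<And>j. 0 < a j"
    "\<And>p q. trace (mpow C p ** mpow A q) =
      complex_of_real (\<Sum>(i, j)\<in>(UNIV :: ('m \<times> 'm) set). w i j * (c i powr p * a j powr q))"
proof -
  obtain U c where U: "unitary U" "\<And>i. 0 < c i" and C: "C = U ** real_diag c ** ctranspose U"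
    using pos_def_diagonalization[OF assms(2)] by blast
  obtain V a where V: "unitary V" "\<And>i. 0 < a i" and A: "A = V ** real_diag a ** ctranspose V"
    using pos_def_diagonalization[OF assms(1)] by blast
  define X where "X = ctranspose U ** V"
  have "trace (mpow C p ** mpow A q) =
      of_real (\<Sum>(i, j)\<in>(UNIV :: ('m \<times> 'm) set). (cmod (X $ i $ j))\<^sup>2 * (c i powr p * a j powr q))"
    for p q
  proof -
    define D E :: "complex^'m^'m"
      where "D = real_diag (\<lambda>i. c i powr p)" and "E = real_diag (\<lambda>j. a j powr q)"
    have eq: "mpow C p ** mpow A q = U ** (D ** X ** E ** ctranspose V)"
      unfolding A C mpow_unitary_diag[OF U(1)] mpow_unitary_diag[OF V(1)]
      by (simp only: D_def E_def X_def matrix_mul_assoc)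
    have "trace (mpow C p ** mpow A q) = trace ((D ** X ** E ** ctranspose V) ** U)"
      unfolding eq by (rule trace_mul_sym)
    also have "\<dots> = trace ((D ** X ** E) ** ctranspose X)"
      by (simp add: X_def ctranspose_mult matrix_mul_assoc)
    also have "\<dots> = (\<Sum>i\<in>UNIV. \<Sum>j\<in>UNIV. (D ** X ** E) $ i $ j * cnj (X $ i $ j))"
      by (simp add: trace_def matrix_matrix_mult_def[of "D ** X ** E"] ctranspose_def)
    also have "\<dots> = (\<Sum>i\<in>UNIV. \<Sum>j\<in>UNIV.
        of_real ((cmod (X $ i $ j))\<^sup>2 * (c i powr p * a j powr q)))"
      unfolding D_def E_def real_diag_mult_right real_diag_mult_left
      by (intro sum.cong refl) (simp only: of_real_mult complex_norm_square mult_ac)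
    finally show ?thesis
      by (simp only: sum.cartesian_product UNIV_Times_UNIV of_real_sum case_prod_unfold)
  qed
  with that[of "\<lambda>i j. (cmod (X $ i $ j))\<^sup>2" c a] U V show ?thesis
    by simp
qed

lemma trace_mpow_log_convex:
  fixes A C :: "complex^'m^'m"
  assumes "A \<in> pos_def" and "C \<in> pos_def" and t: "t \<in> {0..1}"
  shows "trace (mpow C ((1 - t) * p + t * p') ** mpow A ((1 - t) * q + t * q')) \<le>
    trace (mpow C p ** mpow A q) powr of_real (1 - t) *
    trace (mpow C p' ** mpow A q') powr of_real t"
proof -
  obtain w c a where w: "\<And>i j. 0 \<le> w i j" and c: "\<And>i. 0 < c i" and a: "\<And>j. 0 < a j"
    and tr: "\<And>p q. trace (mpow C p ** mpow A q) =
      of_real (\<Sum>(i, j)\<in>(UNIV :: ('m \<times> 'm) set). w i j * (c i powr p * a j powr q))"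
    using trace_mpow_mult[OF assms(1,2)] by blast
  define h where "h p q = (\<Sum>k\<in>(UNIV :: ('m \<times> 'm) set).
    w (fst k) (snd k) * (c (fst k) powr p * a (snd k) powr q))" for p q
  have tr': "trace (mpow C p ** mpow A q) = of_real (h p q)" for p q
    by (simp add: tr h_def case_prod_beta)
  have h_nonneg: "0 \<le> h p q" for p q
    unfolding h_def using w by (intro sum_nonneg) simp
  have "h ((1 - t) * p + t * p') ((1 - t) * q + t * q') =
      (\<Sum>k\<in>UNIV. w (fst k) (snd k) * ((c (fst k) powr p * a (snd k) powr q) powr (1 - t) *
        (c (fst k) powr p' * a (snd k) powr q') powr t))"
    unfolding h_def by (intro sum.cong refl) (simp add: powr_mult powr_powr powr_add mult_ac)
  also have "\<dots> \<le> h p q powr (1 - t) * h p' q' powr t"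
    unfolding h_def using w c a t
    by (intro Hoelder_weighted_sum) (auto simp: less_imp_neq[symmetric])
  finally show ?thesis
    by (simp add: tr' powr_of_real h_nonneg less_eq_complex_def flip: of_real_mult of_real_diff)
qed

section \<open>The trace of the weighted spectral geometric mean\<close>

text \<open>
  The two outer square roots of the geometric mean meet under the trace. They recombine to the mean
  itself because it is positive definite, being congruent to \<open>C\<^sup>t\<close>; the remaining powers are all powers
  of \<open>A\<close> and their exponents add up to \<open>-1/2 + (2 - 2t) - 1/2 = 1 - 2t\<close>.
\<close>

lemma trace_spectral_geom_mean:
  fixes A B :: "complex^'m^'m"
  assumes A: "A \<in> pos_def" and B: "B \<in> pos_def"
  defines "C \<equiv> mpow A (1/2) ** B ** mpow A (1/2)"
  shows "trace (spectral_geom_mean t A B) = trace (mpow C t ** mpow A (1 - 2 * t))"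
proof -
  have C: "C \<in> pos_def"
    using pos_def_congruence[OF B mpow_invertible[OF A, of "1/2"]]
    by (simp add: C_def mpow_hermitian[OF A])
  define G where "G = geom_mean t (matrix_inv A) B"
  have G_eq: "G = mpow A (-1/2) ** mpow C t ** mpow A (-1/2)"
    by (simp add: G_def geom_mean_def mpow_matrix_inv[OF A] C_def)
  have "G \<in> pos_def"
    using pos_def_congruence[OF mpow_pos_def[OF C] mpow_invertible[OF A, of "-1/2"]]
    by (simp add: G_eq mpow_hermitian[OF A])
  then have G2: "mpow G (1/2) ** mpow G (1/2) = G"
    by (simp add: mpow_add mpow_one)
  have "trace (spectral_geom_mean t A B) = trace ((mpow G (1/2) ** mpow A (2 - 2 * t)) ** mpow G (1/2))"
    by (simp add: spectral_geom_mean_def G_def)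
  also have "\<dots> = trace ((mpow G (1/2) ** mpow G (1/2)) ** mpow A (2 - 2 * t))"
    by (subst trace_mul_sym) (simp only: matrix_mul_assoc)
  also have "\<dots> = trace (mpow A (-1/2) ** (mpow C t ** mpow A (-1/2) ** mpow A (2 - 2 * t)))"
    by (simp only: G2) (simp only: G_eq matrix_mul_assoc)
  also have "\<dots> = trace (mpow C t ** (mpow A (-1/2) ** mpow A (2 - 2 * t) ** mpow A (-1/2)))"
    by (subst trace_mul_sym) (simp only: matrix_mul_assoc)
  also have "mpow A (-1/2) ** mpow A (2 - 2 * t) ** mpow A (-1/2) = mpow A (1 - 2 * t)"
    by (simp add: mpow_add[OF A])
  finally show ?thesis .
qed

theorem theorem3p7:
  fixes A B :: "complex^'m^'m" and t :: real
  assumes "A \<in> pos_def" and "B \<in> pos_def" and "t \<in> {0..1}"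
  shows "trace (spectral_geom_mean t A B) \<le>
    trace A powr complex_of_real (1 - t) * trace B powr complex_of_real t"
proof -
  define C where "C = mpow A (1/2) ** B ** mpow A (1/2)"
  have C: "C \<in> pos_def"
    using pos_def_congruence[OF assms(2) mpow_invertible[OF assms(1), of "1/2"]]
    by (simp add: C_def mpow_hermitian[OF assms(1)])
  have trA: "trace (mpow C 0 ** mpow A 1) = trace A"
    using assms(1) C by (simp add: mpow_zero mpow_one)
  have "trace (mpow C 1 ** mpow A (- 1)) =
      trace (mpow A (1/2) ** (B ** (mpow A (1/2) ** mpow A (- 1))))"
    unfolding mpow_one[OF C] by (simp only: C_def matrix_mul_assoc)
  also have "\<dots> = trace (B ** (mpow A (1/2) ** mpow A (- 1) ** mpow A (1/2)))"
    by (subst trace_mul_sym) (simp only: matrix_mul_assoc)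
  also have "\<dots> = trace B"
    using assms(1) by (simp add: mpow_add mpow_zero)
  finally have trB: "trace (mpow C 1 ** mpow A (- 1)) = trace B" .
  \<comment> \<open>The segment of exponents from \<open>(0, 1)\<close> to \<open>(1, -1)\<close> passes through \<open>(t, 1 - 2t)\<close>.\<close>
  show ?thesis
    using trace_mpow_log_convex[OF assms(1) C assms(3), of 0 1 1 "- 1"]
      trace_spectral_geom_mean[OF assms(1,2), of t] trA trB
    by (simp flip: C_def)
qed

end
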